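(* Let $\kappa$ be an uncountable regular cardinal and let $E\subseteq{}^\kappa\kappa$ be a closed set that is a continuous image of ${}^\kappa\kappa$. Then there is $X\subseteq E$ with $|X|\le\kappa^{<\kappa}$ such that $E\setminus X$ is closed and, for every $x_0\in E\setminus X$, Player II has a winning strategy in the game $G_\kappa(E,x_0,\omega+1)$.
   Context: ${}^\kappa\kappa$ carries the topology generated by the sets $N_\sigma=\{x\in{}^\kappa\kappa:\sigma\sqsubseteq x\}$, $\sigma\in{}^{<\kappa}\kappa$. For $E\subseteq{}^\kappa\kappa$, $x_0\in{}^\kappa\kappa$ and an infinite ordinal $\delta\le\kappa$, the game $G_\kappa(E,x_0,\delta)$ has rounds indexed by $1\le\xi<\delta$; in round $\xi$ Player I plays an ordinal $\alpha_\xi<\kappa$ and then Player II plays $x_\xi\in E$, subject to: $\langle\alpha_\xi:1\le\xi<\delta\rangle$ is increasing and continuous, and for all $0\le\eta<\xi<\delta$, $x_\eta\ne x_\xi$ and $x_\eta\restriction\alpha_{\eta+1}=x_\xi\restriction\alpha_{\eta+1}$. Player II wins if they can legally play in every round $1\le\xi<\delta$ (so for $\delta=\omega+1$, in all rounds $1\le\xi\le\omega$). *)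

theory Defs
  imports "HOL-Analysis.Analysis"
begin

unbundle cardinal_syntax

text \<open>
  The cardinal \<open>\<kappa>\<close> is the universe of a well-ordered type \<open>'k\<close>, and the ordinals below \<open>\<kappa>\<close> are
  the elements of \<open>'k\<close>: the hypothesis \<open>card_order kappa\<close> says that the order type of \<open>'k\<close> is an
  initial ordinal. The set of all functions from \<open>\<kappa>\<close> to \<open>\<kappa>\<close> is then the type \<open>'k \<Rightarrow> 'k\<close>.
\<close>

definition kappa :: "'k::wellorder rel" where
  "kappa = {(\<alpha>, \<beta>). \<alpha> \<le> \<beta>}"

definition uncountable_regular_cardinal :: "'k::wellorder itself \<Rightarrow> bool" where
  "uncountable_regular_cardinal _ \<longleftrightarrow>
     card_order (kappa :: 'k rel) \<and> regularCard (kappa :: 'k rel) \<and> uncountable (UNIV :: 'k set)"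

definition ord_zero :: "'k::wellorder" where
  "ord_zero = (LEAST \<alpha>. True)"

definition ord_succ :: "'k::wellorder \<Rightarrow> 'k" where
  "ord_succ \<alpha> = (LEAST \<beta>. \<alpha> < \<beta>)"

definition ord_limit :: "'k::wellorder \<Rightarrow> bool" where
  "ord_limit \<alpha> \<longleftrightarrow> ord_zero < \<alpha> \<and> (\<forall>\<beta><\<alpha>. ord_succ \<beta> < \<alpha>)"

definition ord_omega :: "'k::wellorder" where
  "ord_omega = (LEAST \<alpha>. infinite {..<\<alpha>})"

text \<open>
  The sequences of length less than \<open>\<kappa>\<close>, as partial functions whose domain is a proper initial
  segment. The cardinal \<open>\<kappa>\<^sup><\<^sup>\<kappa>\<close> is the cardinality of this set.
\<close>

definition short_seqs :: "('k::wellorder \<rightharpoonup> 'k) set" where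
  "short_seqs = {\<sigma>. \<exists>\<alpha>. dom \<sigma> = {..<\<alpha>}}"

definition basic_nbhd :: "('k \<rightharpoonup> 'k) \<Rightarrow> ('k::wellorder \<Rightarrow> 'k) set" where
  "basic_nbhd \<sigma> = {x. \<sigma> \<subseteq>\<^sub>m (Some \<circ> x)}"

definition baire_top :: "('k::wellorder \<Rightarrow> 'k) topology" where
  "baire_top = topology_generated_by (basic_nbhd ` short_seqs)"

text \<open>
  The game. As usual an ordinal \<open>\<delta> \<le> \<kappa>\<close> is the set of its elements, so it is an
  initial segment of \<open>'k\<close>: \<open>{..<\<gamma>}\<close> for \<open>\<gamma> < \<kappa>\<close>, or \<open>UNIV\<close> for \<open>\<kappa>\<close> itself.
  A run consists of the moves \<open>\<alpha> \<xi>\<close> of Player I and \<open>x \<xi>\<close> of Player II for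
  \<open>1 \<le> \<xi> < \<delta>\<close>, with \<open>x 0\<close> the given starting point; other values of \<open>\<alpha>\<close> and \<open>x\<close> are irrelevant.
\<close>

text \<open>
  The moves of Player I up to and including round \<open>\<xi>\<close> are legal: they are strictly increasing, and at
  limit rounds the supremum of the previous moves is played.
\<close>

definition legal_I :: "('k::wellorder \<Rightarrow> 'k) \<Rightarrow> 'k \<Rightarrow> bool" where
  "legal_I \<alpha> \<xi> \<longleftrightarrow>
     strict_mono_on {ord_zero<..\<xi>} \<alpha> \<and>
     (\<forall>\<zeta>\<le>\<xi>. ord_limit \<zeta> \<longrightarrow> \<alpha> \<zeta> = (LEAST \<beta>. \<forall>\<eta>\<in>{ord_zero<..<\<zeta>}. \<alpha> \<eta> \<le> \<beta>))"

definition legal_II ::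
    "('k \<Rightarrow> 'k) set \<Rightarrow> ('k::wellorder \<Rightarrow> 'k) \<Rightarrow> ('k \<Rightarrow> 'k \<Rightarrow> 'k) \<Rightarrow> 'k \<Rightarrow> bool" where
  "legal_II E \<alpha> x \<xi> \<longleftrightarrow>
     x \<xi> \<in> E \<and> (\<forall>\<eta><\<xi>. x \<eta> \<noteq> x \<xi> \<and> (\<forall>\<beta> < \<alpha> (ord_succ \<eta>). x \<eta> \<beta> = x \<xi> \<beta>))"

text \<open>
  A strategy for Player II maps the position in round \<open>\<xi>\<close>, i.e. the moves of Player I in the
  rounds up to and including \<open>\<xi>\<close> together with the starting point and the earlier moves of Player II,
  to a move. The position is passed as a pair of partial functions, so nothing later can be used.
\<close>

type_synonym 'k strategy = "('k \<rightharpoonup> 'k) \<Rightarrow> ('k \<rightharpoonup> ('k \<Rightarrow> 'k)) \<Rightarrow> ('k \<Rightarrow> 'k)"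

definition follows ::
    "'k::wellorder set \<Rightarrow> 'k strategy \<Rightarrow> ('k \<Rightarrow> 'k) \<Rightarrow> ('k \<Rightarrow> 'k \<Rightarrow> 'k) \<Rightarrow> bool" where
  "follows \<delta> \<tau> \<alpha> x \<longleftrightarrow>
     (\<forall>\<xi>\<in>\<delta>. ord_zero < \<xi> \<longrightarrow>
        x \<xi> = \<tau> ((Some \<circ> \<alpha>) |` {ord_zero<..\<xi>}) ((Some \<circ> x) |` {..<\<xi>}))"

text \<open>
  Player II must answer legally in every round as long as Player I has played legally; if Player I
  breaks the rules or has no legal move left, Player II has nothing more to do.
\<close>

definition winning_strategy_II ::
    "('k::wellorder \<Rightarrow> 'k) set \<Rightarrow> ('k \<Rightarrow> 'k) \<Rightarrow> 'k set \<Rightarrow> 'k strategy \<Rightarrow> bool" where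
  "winning_strategy_II E x\<^sub>0 \<delta> \<tau> \<longleftrightarrow>
     (\<forall>\<alpha> x. x ord_zero = x\<^sub>0 \<and> follows \<delta> \<tau> \<alpha> x \<longrightarrow>
        (\<forall>\<xi>\<in>\<delta>. ord_zero < \<xi> \<and> legal_I \<alpha> \<xi> \<longrightarrow> legal_II E \<alpha> x \<xi>))"

text \<open>The ordinal \<open>\<omega> + 1\<close> is the set of the ordinals up to and including \<open>\<omega>\<close>.\<close>

definition omega_plus_one :: "'k::wellorder set" where
  "omega_plus_one = {..ord_omega}"

end

theory Submission
  imports Defs
begin

text \<open>
  Call a subset of \<open>E\<close> small if it has at most \<open>\<kappa>\<^sup><\<^sup>\<kappa>\<close> elements, and let \<open>X\<close> be the union of all
  small relatively basic open subsets of \<open>E\<close>. Let \<open>f\<close> be a continuous surjection from the whole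
  space onto \<open>E\<close>, and call \<open>y\<close> a kernel point if no basic neighbourhood of \<open>y\<close> has a small
  image. All but a small set of points of \<open>E\<close> are images of kernel points only, so every set with a
  large image contains kernel points with at least two images. Player II answers with images
  \<open>x\<^sub>n = f y\<^sub>n\<close> of kernel points, where \<open>y\<^sub>n\<^sub>+\<^sub>1\<close> extends an initial segment \<open>\<sigma>\<^sub>n\<close> of \<open>y\<^sub>n\<close>, itself
  extending \<open>\<sigma>\<^sub>n\<^sub>-\<^sub>1\<close>, so long that all images of extensions of \<open>\<sigma>\<^sub>n\<close> agree with \<open>x\<^sub>n\<close> below
  \<open>\<alpha>\<^sub>n\<^sub>+\<^sub>1\<close> and differ from all \<open>x\<^sub>i\<close> with \<open>i < n\<close>. In round \<open>\<omega>\<close> the image of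
  any common extension of the \<open>\<sigma>\<^sub>n\<close> is a legal answer.
\<close>

section \<open>Basic neighbourhoods as sets of functions agreeing below a bound\<close>

definition agree :: "'k::wellorder \<Rightarrow> ('k \<Rightarrow> 'k) \<Rightarrow> ('k \<Rightarrow> 'k) \<Rightarrow> bool" where
  "agree \<beta> y z \<longleftrightarrow> (\<forall>\<gamma><\<beta>. y \<gamma> = z \<gamma>)"

lemma agree_refl [simp]: "agree \<beta> y y"
  by (simp add: agree_def)

lemma agree_trans: "agree \<beta> x y \<Longrightarrow> agree \<beta> y z \<Longrightarrow> agree \<beta> x z"
  by (simp add: agree_def)

lemma agree_mono: "agree \<beta> y z \<Longrightarrow> \<alpha> \<le> \<beta> \<Longrightarrow> agree \<alpha> y z"
  by (auto simp: agree_def)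

lemma basic_nbhd_agree:
  assumes "dom \<sigma> = {..<\<beta>}" "y \<in> basic_nbhd \<sigma>"
  shows "basic_nbhd \<sigma> = {z. agree \<beta> y z}"
proof -
  have \<sigma>: "\<sigma> \<gamma> = (if \<gamma> < \<beta> then Some (y \<gamma>) else None)" for \<gamma>
    using assms by (auto simp: basic_nbhd_def map_le_def domIff)
  show ?thesis
    by (auto simp: basic_nbhd_def map_le_def agree_def assms(1) \<sigma>)
qed

lemma ex_basic_nbhd_agree: "\<exists>\<sigma>\<in>short_seqs. {z. agree \<beta> y z} = basic_nbhd \<sigma>"
proof -
  let ?\<sigma> = "(Some \<circ> y) |` {..<\<beta>}"
  have d: "dom ?\<sigma> = {..<\<beta>}" by auto
  moreover have "y \<in> basic_nbhd ?\<sigma>"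
    by (auto simp: basic_nbhd_def map_le_def)
  ultimately show ?thesis
    using basic_nbhd_agree unfolding short_seqs_def by blast
qed

lemma openin_baire_basic_nbhd: "\<sigma> \<in> short_seqs \<Longrightarrow> openin baire_top (basic_nbhd \<sigma>)"
  unfolding baire_top_def by (blast intro: topology_generated_by_Basis)

lemma openin_baire_agree: "openin baire_top {z. agree \<beta> y z}"
  using ex_basic_nbhd_agree[of \<beta> y] openin_baire_basic_nbhd by auto

lemma topspace_baire_top [simp]: "topspace baire_top = UNIV"
  using openin_subset[OF openin_baire_agree] agree_refl by blast

text \<open>A basic set is such a neighbourhood of each of its points, and the neighbourhoods of
  \<open>y\<close> are nested, so finite intersections only need the larger bound.\<close>

lemma openin_baire_nbhd:
  assumes "openin baire_top U" "y \<in> U"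
  shows "\<exists>\<beta>. {z. agree \<beta> y z} \<subseteq> U"
proof -
  have "generate_topology_on (basic_nbhd ` short_seqs) U"
    using assms(1) by (simp add: baire_top_def openin_topology_generated_by_iff)
  then show ?thesis
    using assms(2)
  proof induction
    case (Int A B)
    then obtain \<alpha> \<beta> where "{z. agree \<alpha> y z} \<subseteq> A" "{z. agree \<beta> y z} \<subseteq> B" by blast
    moreover have "agree \<alpha> y z \<and> agree \<beta> y z" if "agree (max \<alpha> \<beta>) y z" for z
      using that agree_mono max.cobounded1 max.cobounded2 by metis
    ultimately show ?case by blast
  next
    case (Basis s)
    then show ?case
      using basic_nbhd_agree unfolding short_seqs_def by blast
  qed blast+
qed

lemma continuous_map_baire_agree:
  assumes "continuous_map baire_top baire_top f"
  shows "\<exists>\<beta>. \<forall>z. agree \<beta> y z \<longrightarrow> agree \<alpha> (f y) (f z)"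
proof -
  have "openin baire_top {z. agree \<alpha> (f y) (f z)}"
    using openin_continuous_map_preimage[OF assms openin_baire_agree, of \<alpha> "f y"] by simp
  from openin_baire_nbhd[OF this, of y] show ?thesis by auto
qed

section \<open>Small sets and kernel points\<close>

abbreviation small :: "('k::wellorder \<Rightarrow> 'k) set \<Rightarrow> bool" where
  "small A \<equiv> |A| \<le>o |short_seqs :: ('k \<rightharpoonup> 'k) set|"

definition kernel :: "(('k::wellorder \<Rightarrow> 'k) \<Rightarrow> ('k \<Rightarrow> 'k)) \<Rightarrow> ('k \<Rightarrow> 'k) set" where
  "kernel f = {y. \<forall>\<beta>. \<not> small (f ` {z. agree \<beta> y z})}"

text \<open>Restricting the identity to the segments below \<beta> embeds \<open>'k\<close> into the
  short sequences.\<close>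

lemma infinite_short_seqs:
  assumes "infinite (UNIV :: 'k::wellorder set)"
  shows "infinite (short_seqs :: ('k \<rightharpoonup> 'k) set)"
proof
  let ?g = "\<lambda>\<beta>::'k. (Some :: 'k \<Rightarrow> _) |` {..<\<beta>}"
  have d: "dom (?g \<beta>) = {..<\<beta>}" for \<beta> by auto
  assume "finite (short_seqs :: ('k \<rightharpoonup> 'k) set)"
  moreover have "range ?g \<subseteq> short_seqs"
    unfolding short_seqs_def using d by blast
  moreover have "inj ?g"
    by (rule injI) (metis d lessThan_eq_iff)
  ultimately show False
    using assms finite_subset finite_imageD by blast
qed

text \<open>The index set lies in the infinite set \<open>short_seqs\<close>, so cardinal arithmetic
  absorbs the union. This bounds both the values at non-kernel points and the exceptional set of the
  theorem.\<close>

lemma small_UN_basic_nbhd: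
  fixes A :: "('k::wellorder \<rightharpoonup> 'k) \<Rightarrow> ('k \<Rightarrow> 'k) set"
  assumes "infinite (UNIV :: 'k set)"
  shows "small (\<Union>\<sigma>\<in>{\<sigma>\<in>short_seqs. small (A \<sigma>)}. A \<sigma>)"
  by (rule card_of_UNION_ordLeq_infinite[OF infinite_short_seqs[OF assms]])
    (auto intro: card_of_mono1)

text \<open>Each non-kernel point lies in a basic set with small image, so all values at such points
  lie in the single small set \<open>?U\<close>. If \<open>f\<close> took only the value
  \<open>x\<close> at kernel points of \<open>A\<close>, the image of \<open>A\<close> would lie in
  \<open>?U \<union> {x}\<close>, which is still small.\<close>

lemma kernel_point_other_value:
  fixes f :: "('k::wellorder \<Rightarrow> 'k) \<Rightarrow> ('k \<Rightarrow> 'k)"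
  assumes inf: "infinite (UNIV :: 'k set)" and large: "\<not> small (f ` A)"
  shows "\<exists>y\<in>A \<inter> kernel f. f y \<noteq> x"
proof (rule ccontr)
  let ?U = "\<Union>\<sigma>\<in>{\<sigma>\<in>short_seqs. small (f ` basic_nbhd \<sigma>)}. f ` basic_nbhd \<sigma>"
  assume contr: "\<not> ?thesis"
  have "f y \<in> ?U" if y: "y \<notin> kernel f" for y
  proof -
    obtain \<beta> where \<beta>: "small (f ` {z. agree \<beta> y z})"
      using y unfolding kernel_def by blast
    obtain \<sigma> where "\<sigma> \<in> short_seqs" "{z. agree \<beta> y z} = basic_nbhd \<sigma>"
      using ex_basic_nbhd_agree by blast
    moreover from this have "y \<in> basic_nbhd \<sigma>" by auto
    ultimately show ?thesis using \<beta> by auto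
  qed
  then have "f ` A \<subseteq> ?U \<union> {x}"
    using contr by blast
  moreover have "small (?U \<union> {x})"
  proof (rule card_of_Un_ordLeq_infinite_Field)
    show "small ?U" by (rule small_UN_basic_nbhd[OF inf])
    show "small {x}"
      using infinite_short_seqs[OF inf] by (intro card_of_singl_ordLeq) auto
  qed (simp_all add: Field_card_of card_of_card_order_on infinite_short_seqs[OF inf])
  ultimately show False
    using large card_of_mono1 ordLeq_transitive by blast
qed

section \<open>Unboundedness, separation, and the construction of Player II's answers\<close>

lemma ex_greater:
  assumes "uncountable_regular_cardinal TYPE('k::wellorder)"
  shows "\<exists>\<beta>::'k. \<alpha> < \<beta>"
proof -
  have "Card_order (kappa :: 'k rel)" "Field (kappa :: 'k rel) = UNIV"
    using assms card_order_on_Card_order unfolding uncountable_regular_cardinal_def by blast+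
  moreover have "infinite (UNIV :: 'k set)"
    using assms countable_finite unfolding uncountable_regular_cardinal_def by blast
  ultimately obtain \<beta> where "\<alpha> \<noteq> \<beta>" "(\<alpha>, \<beta>) \<in> kappa"
    using infinite_Card_order_limit[of "kappa :: 'k rel" \<alpha>] by auto
  then show ?thesis by (auto simp: kappa_def less_le)
qed

lemma isolate_from_finite:
  fixes x :: "'k::wellorder \<Rightarrow> 'k"
  assumes unbounded: "\<And>\<alpha>::'k. \<exists>\<beta>. \<alpha> < \<beta>" and "finite F" "x \<notin> F"
  shows "\<exists>\<beta>. \<forall>z\<in>F. \<not> agree \<beta> x z"
  using assms(2,3)
proof (induction F)
  case (insert w F)
  then obtain \<beta> where \<beta>: "\<forall>z\<in>F. \<not> agree \<beta> x z" by auto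
  obtain \<gamma> where "x \<gamma> \<noteq> w \<gamma>" using insert.prems by auto
  moreover obtain \<delta> where "\<gamma> < \<delta>" using unbounded by blast
  ultimately have "\<not> agree \<delta> x w" by (auto simp: agree_def)
  then have "\<forall>z\<in>insert w F. \<not> agree (max \<beta> \<delta>) x z"
    using \<beta> agree_mono max.cobounded1 max.cobounded2 by (metis insert_iff)
  then show ?case ..
qed simp

text \<open>
  A state consists of a kernel point \<open>y\<close>, the length \<open>b\<close> of the initial segment of \<open>y\<close> that all later
  points share, and the set \<open>F\<close> of the earlier positions of the run.
\<close>

type_synonym 'k state = "('k \<Rightarrow> 'k) \<times> 'k \<times> ('k \<Rightarrow> 'k) set"

definition state_inv :: "(('k::wellorder \<Rightarrow> 'k) \<Rightarrow> ('k \<Rightarrow> 'k)) \<Rightarrow> 'k state \<Rightarrow> bool" where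
  "state_inv f = (\<lambda>(y, b, F). y \<in> kernel f \<and> finite F \<and> f y \<notin> F)"

text \<open>The last clause concerns all extensions of the kept segment, so it also applies to a
  common extension in round \<omega>. It excludes only \<open>F\<close>, not yet \<open>f y\<close>:
  \<open>state_inv\<close> keeps the next value off \<open>f y\<close>, and the next step excludes
  \<open>f y\<close> for all extensions.\<close>

definition state_step ::
    "(('k::wellorder \<Rightarrow> 'k) \<Rightarrow> ('k \<Rightarrow> 'k)) \<Rightarrow> 'k \<Rightarrow> 'k state \<Rightarrow> 'k state \<Rightarrow> bool" where
  "state_step f \<alpha> = (\<lambda>(y, b, F) (y', b', F').
     b \<le> b' \<and> agree b' y y' \<and> F' = insert (f y) F \<and>
     (\<forall>z. agree b' y z \<longrightarrow> agree \<alpha> (f y) (f z) \<and> f z \<notin> F))"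

lemma ex_state_step:
  fixes f :: "('k::wellorder \<Rightarrow> 'k) \<Rightarrow> ('k \<Rightarrow> 'k)"
  assumes unbounded: "\<And>\<alpha>::'k. \<exists>\<beta>. \<alpha> < \<beta>" and inf: "infinite (UNIV :: 'k set)"
    and cont: "continuous_map baire_top baire_top f" and inv: "state_inv f s"
  shows "\<exists>s'. state_inv f s' \<and> state_step f \<alpha> s s'"
proof -
  obtain y b F where s: "s = (y, b, F)" by (cases s)
  have y: "y \<in> kernel f" "finite F" "f y \<notin> F" using inv by (auto simp: s state_inv_def)
  \<comment> \<open>Agreement up to \<gamma> with \<open>f y\<close> already keeps a value off the
    earlier positions; one use of continuity then serves both the demand \<alpha> and this
    exclusion.\<close>
  obtain \<gamma> where \<gamma>: "\<forall>z\<in>F. \<not> agree \<gamma> (f y) z"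
    using isolate_from_finite[OF unbounded y(2,3)] by blast
  obtain \<beta> where \<beta>: "\<forall>z. agree \<beta> y z \<longrightarrow> agree (max \<alpha> \<gamma>) (f y) (f z)"
    using continuous_map_baire_agree[OF cont] by blast
  define b' where "b' = max b \<beta>"
  have near: "agree \<alpha> (f y) (f z) \<and> f z \<notin> F" if "agree b' y z" for z
  proof -
    have "agree (max \<alpha> \<gamma>) (f y) (f z)"
      using that \<beta> agree_mono[of b' y z \<beta>] by (simp add: b'_def)
    then show ?thesis
      using \<gamma> agree_mono[of "max \<alpha> \<gamma>" "f y" "f z"] by auto
  qed
  \<comment> \<open>Since \<open>y\<close> is a kernel point, even the neighbourhood given by
    \<open>b'\<close> has a large image, which leaves room for a kernel point with a new
    value.\<close>
  have "\<not> small (f ` {z. agree b' y z})"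
    using y(1) by (simp add: kernel_def)
  then obtain y' where y': "agree b' y y'" "y' \<in> kernel f" "f y' \<noteq> f y"
    using kernel_point_other_value[OF inf, of f _ "f y"] by blast
  have "state_inv f (y', b', insert (f y) F)" "state_step f \<alpha> s (y', b', insert (f y) F)"
    using y y' near by (auto simp: state_inv_def state_step_def s b'_def)
  then show ?thesis by blast
qed

text \<open>This supplies round 1. The starting point is not assumed to be the image of a kernel
  point, so the first kernel point is sought among the preimages of its large neighbourhood.\<close>

lemma ex_initial_state:
  fixes f :: "('k::wellorder \<Rightarrow> 'k) \<Rightarrow> ('k \<Rightarrow> 'k)"
  assumes inf: "infinite (UNIV :: 'k set)"
    and cont: "continuous_map baire_top baire_top f"
    and large: "\<not> small (range f \<inter> {x. agree \<alpha> x\<^sub>0 x})"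
  shows "\<exists>y b. state_inv f (y, b, {x\<^sub>0}) \<and> (\<forall>z. agree b y z \<longrightarrow> agree \<alpha> x\<^sub>0 (f z))"
proof -
  have "range f \<inter> {x. agree \<alpha> x\<^sub>0 x} = f ` {y. agree \<alpha> x\<^sub>0 (f y)}" by auto
  with large have "\<not> small (f ` {y. agree \<alpha> x\<^sub>0 (f y)})" by simp
  from kernel_point_other_value[OF inf this, of x\<^sub>0]
  obtain y where y: "agree \<alpha> x\<^sub>0 (f y)" "y \<in> kernel f" "f y \<noteq> x\<^sub>0" by blast
  obtain b where "\<forall>z. agree b y z \<longrightarrow> agree \<alpha> (f y) (f z)"
    using continuous_map_baire_agree[OF cont] by blast
  with y have "state_inv f (y, b, {x\<^sub>0}) \<and> (\<forall>z. agree b y z \<longrightarrow> agree \<alpha> x\<^sub>0 (f z))"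
    by (auto simp: state_inv_def intro: agree_trans)
  then show ?thesis by blast
qed

lemma ex_common_extension:
  fixes y :: "nat \<Rightarrow> 'k::wellorder \<Rightarrow> 'k"
  assumes "\<And>m n. m \<le> n \<Longrightarrow> agree (b m) (y m) (y n)"
  shows "\<exists>z. \<forall>n. agree (b n) (y n) z"
proof -
  \<comment> \<open>Each coordinate is read off the first segment that reaches it; coherence makes
    later segments give the same value. Beyond all \<open>b n\<close> any value will do.\<close>
  define z where "z \<gamma> = y (LEAST n. \<gamma> < b n) \<gamma>" for \<gamma>
  have "y n \<gamma> = z \<gamma>" if "\<gamma> < b n" for n \<gamma>
  proof -
    have "\<gamma> < b (LEAST n. \<gamma> < b n)" using that by (rule LeastI)
    moreover have "(LEAST n. \<gamma> < b n) \<le> n" using that by (rule Least_le)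
    ultimately show ?thesis
      using assms by (simp add: z_def agree_def)
  qed
  then show ?thesis by (auto simp: agree_def)
qed

text \<open>
  Here \<open>a n\<close> is Player I's move in round \<open>n + 1\<close>, \<open>X a n\<close> is the answer of Player II in
  round \<open>n\<close>, and \<open>L a\<close> is the answer in round \<open>\<omega>\<close>.
\<close>

lemma ex_nat_strategy:
  fixes f :: "('k::wellorder \<Rightarrow> 'k) \<Rightarrow> ('k \<Rightarrow> 'k)"
  assumes unbounded: "\<And>\<alpha>::'k. \<exists>\<beta>. \<alpha> < \<beta>" and inf: "infinite (UNIV :: 'k set)"
    and cont: "continuous_map baire_top baire_top f"
    and large: "\<And>\<alpha>. \<not> small (range f \<inter> {x. agree \<alpha> x\<^sub>0 x})"
  obtains X L where
    "\<And>a. X a 0 = x\<^sub>0"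
    "\<And>a a' n. (\<And>i. i < n \<Longrightarrow> a i = a' i) \<Longrightarrow> X a n = X a' n"
    "\<And>a n. X a (Suc n) \<in> range f"
    "\<And>a m n. m < n \<Longrightarrow> X a m \<noteq> X a n \<and> agree (a m) (X a m) (X a n)"
    "\<And>a. L a \<in> range f"
    "\<And>a n. X a n \<noteq> L a \<and> agree (a n) (X a n) (L a)"
proof -
  have "\<exists>s. state_inv f s \<and> snd (snd s) = {x\<^sub>0} \<and>
      (\<forall>z. agree (fst (snd s)) (fst s) z \<longrightarrow> agree \<alpha> x\<^sub>0 (f z))" for \<alpha>
    using ex_initial_state[OF inf cont large, of \<alpha>] by auto
  then obtain init where init: "\<And>\<alpha>. state_inv f (init \<alpha>)" "\<And>\<alpha>. snd (snd (init \<alpha>)) = {x\<^sub>0}"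
      "\<And>\<alpha> z. agree (fst (snd (init \<alpha>))) (fst (init \<alpha>)) z \<Longrightarrow> agree \<alpha> x\<^sub>0 (f z)"
    by metis
  obtain step where step: "\<And>s \<alpha>. state_inv f s \<Longrightarrow> state_inv f (step s \<alpha>)"
      "\<And>s \<alpha>. state_inv f s \<Longrightarrow> state_step f \<alpha> s (step s \<alpha>)"
    using ex_state_step[OF unbounded inf cont] by metis
  \<comment> \<open>\<open>S a n\<close> is the state after the moves \<open>a 0\<close> to
    \<open>a n\<close>; its kernel point yields the answer in round \<open>n + 1\<close>.\<close>
  define S where "S a n = rec_nat (init (a 0)) (\<lambda>n s. step s (a (Suc n))) n" for a :: "nat \<Rightarrow> 'k" and n
  have S_simps: "S a 0 = init (a 0)" "S a (Suc n) = step (S a n) (a (Suc n))" for a n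
    by (simp_all add: S_def)
  have S_cong: "S a n = S a' n" if "\<And>i. i \<le> n \<Longrightarrow> a i = a' i" for a a' n
    using that by (induction n) (simp_all add: S_simps)
  have S_inv: "state_inv f (S a n)" for a n
    by (induction n) (simp_all add: S_simps init step)
  define y where "y a n = fst (S a n)" for a n
  define b where "b a n = fst (snd (S a n))" for a n
  define F where "F a n = snd (snd (S a n))" for a n
  have inv: "f (y a n) \<notin> F a n" for a n
    using S_inv[of a n] by (auto simp: state_inv_def y_def F_def split: prod.splits)
  have state_step_S: "state_step f (a (Suc n)) (S a n) (S a (Suc n))" for a n
    using step(2)[OF S_inv] by (simp add: S_simps)
  have succ: "b a n \<le> b a (Suc n)" "agree (b a (Suc n)) (y a n) (y a (Suc n))"
      "F a (Suc n) = insert (f (y a n)) (F a n)"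
      "\<And>z. agree (b a (Suc n)) (y a n) z \<Longrightarrow> agree (a (Suc n)) (f (y a n)) (f z) \<and> f z \<notin> F a n" for a n
    using state_step_S[of a n]
    by (simp_all add: state_step_def y_def b_def F_def case_prod_unfold)
  have b_mono: "b a m \<le> b a n" if "m \<le> n" for a m n
    using that succ(1) lift_Suc_mono_le by blast
  \<comment> \<open>The segment of \<open>y a m\<close> that is kept has length
    \<open>b a (Suc m)\<close>, as it is fixed in the step leaving \<open>y a m\<close>.\<close>
  have coh: "agree (b a (Suc m)) (y a m) (y a n)" if "m \<le> n" for a m n
    using that
  proof (induction n rule: dec_induct)
    case (step k)
    have "agree (b a (Suc m)) (y a k) (y a (Suc k))"
      using succ(2) b_mono step.hyps by (meson agree_mono Suc_le_mono)
    with step.IH show ?case by (rule agree_trans)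
  qed simp
  \<comment> \<open>The choice may depend on all of \<open>a\<close>, as round \<omega> allows. No
    kernel property is asked of \<open>z a\<close>, since no further round follows.\<close>
  define z where "z a = (SOME z. \<forall>n. agree (b a (Suc n)) (y a n) z)" for a
  have z: "agree (b a (Suc n)) (y a n) (z a)" for a n
    using someI_ex[OF ex_common_extension[of "\<lambda>n. b a (Suc n)" "y a", OF coh]]
    by (simp add: z_def)
  define X where "X a n = (case n of 0 \<Rightarrow> x\<^sub>0 | Suc n \<Rightarrow> f (y a n))" for a n
  \<comment> \<open>Thus \<open>inv\<close> says that the answer in round \<open>n + 1\<close>
    differs from all positions up to round \<open>n\<close>.\<close>
  have F: "F a n = X a ` {..n}" for a n
  proof (induction n)
    case 0
    show ?case by (simp add: F_def S_simps init X_def)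
  next
    case (Suc n)
    have "X a ` {..Suc n} = insert (X a (Suc n)) (X a ` {..n})"
      by (simp add: atMost_Suc)
    with Suc succ(3) show ?case by (simp add: X_def)
  qed
  \<comment> \<open>Truncated subtraction merges two cases: for \<open>m = 0\<close> the initial
    state gives agreement with the starting point, for \<open>m = Suc k\<close> the step leaving
    \<open>y a k\<close> does. In \<open>b_pred\<close> the case \<open>m = 0\<close> merely
    shortens the segment.\<close>
  have ext: "agree (a m) (X a m) (f w)"
    if "agree (b a m) (y a (m - 1)) w" for a m w
  proof (cases m)
    case 0
    with that init(3)[of "a 0" w] show ?thesis
      by (simp add: X_def b_def y_def S_simps)
  next
    case (Suc k)
    with that succ(4)[of a k w] show ?thesis by (simp add: X_def)
  qed
  have b_pred: "agree (b a m) (y a (m - 1)) w" if "agree (b a (Suc (m - 1))) (y a (m - 1)) w" for a m w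
    using that b_mono[of m "Suc (m - 1)" a] agree_mono by fastforce
  show thesis
  proof (rule that[of X "\<lambda>a. f (z a)"])
    show "X a 0 = x\<^sub>0" for a by (simp add: X_def)
    show "X a n = X a' n" if "\<And>i. i < n \<Longrightarrow> a i = a' i" for a a' n
      using that S_cong[of "n - 1" a a'] by (cases n) (auto simp: X_def y_def)
    show "X a (Suc n) \<in> range f" for a n by (simp add: X_def)
    show "X a m \<noteq> X a n \<and> agree (a m) (X a m) (X a n)" if mn: "m < n" for a m n
    proof -
      obtain k where k: "n = Suc k" "m \<le> k" using mn by (cases n) auto
      have "X a m \<in> F a k" using k(2) by (auto simp: F)
      moreover have "agree (a m) (X a m) (f (y a k))"
        using k(2) by (intro ext b_pred coh) simp
      ultimately show ?thesis
        using inv[of a k] k by (auto simp: X_def)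
    qed
    show "f (z a) \<in> range f" for a by simp
    show "X a n \<noteq> f (z a) \<and> agree (a n) (X a n) (f (z a))" for a n
    proof
      have "f (z a) \<notin> F a n" using succ(4)[OF z] by blast
      then show "X a n \<noteq> f (z a)" unfolding F by (metis atMost_iff imageI order_refl)
      show "agree (a n) (X a n) (f (z a))" by (intro ext b_pred z)
    qed
  qed
qed

section \<open>Finite ordinals and \<omega> inside \<open>'k\<close>\<close>

definition ord_nat :: "nat \<Rightarrow> 'k::wellorder" where
  "ord_nat n = (ord_succ ^^ n) ord_zero"

lemma ord_zero_le [simp]: "ord_zero \<le> (\<alpha>::'k::wellorder)"
  unfolding ord_zero_def by (rule Least_le) simp

lemma lessThan_ord_succ:
  fixes \<alpha> :: "'k::wellorder"
  assumes "\<exists>\<beta>. \<alpha> < \<beta>"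
  shows "{..<ord_succ \<alpha>} = {..\<alpha>}"
proof -
  have "\<alpha> < ord_succ \<alpha>"
    unfolding ord_succ_def using assms by (rule LeastI_ex)
  moreover have "\<not> \<alpha> < \<gamma>" if "\<gamma> < ord_succ \<alpha>" for \<gamma>
    using that unfolding ord_succ_def by (rule not_less_Least)
  ultimately show ?thesis by (auto simp: not_less intro: le_less_trans)
qed

context
  assumes unbounded: "\<And>\<alpha>::'k::wellorder. \<exists>\<beta>. \<alpha> < \<beta>"
begin

lemma lessThan_ord_nat:
  "finite {..<ord_nat n :: 'k}" "card {..<ord_nat n :: 'k} = n"
proof (induction n)
  case 0
  have "{..<ord_nat 0 :: 'k} = {}" by (simp add: ord_nat_def lessThan_def not_less)
  then show "finite {..<ord_nat 0 :: 'k}" "card {..<ord_nat 0 :: 'k} = 0" by simp_all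
next
  case (Suc n)
  have "{..<ord_nat (Suc n) :: 'k} = insert (ord_nat n) {..<ord_nat n}"
    using lessThan_ord_succ[OF unbounded] by (auto simp: ord_nat_def)
  with Suc show "finite {..<ord_nat (Suc n) :: 'k}" "card {..<ord_nat (Suc n) :: 'k} = Suc n"
    by simp_all
qed

text \<open>Initial segments are comparable by inclusion, so finite ones of equal cardinality
  coincide.\<close>

lemma finite_lessThan_imp_ord_nat:
  assumes "finite {..<\<xi>::'k}"
  shows "\<xi> = ord_nat (card {..<\<xi>})"
proof (rule ccontr)
  let ?n = "card {..<\<xi>}"
  assume "\<xi> \<noteq> ord_nat ?n"
  then have "{..<\<xi>} \<subset> {..<ord_nat ?n} \<or> {..<ord_nat ?n} \<subset> {..<\<xi>}"
    by (auto simp: psubset_eq neq_iff)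
  then show False
    using psubset_card_mono assms lessThan_ord_nat[of ?n] by (metis less_irrefl)
qed

lemma ord_nat_less_iff: "(ord_nat m :: 'k) < ord_nat n \<longleftrightarrow> m < n"
proof
  assume "(ord_nat m :: 'k) < ord_nat n"
  then have "{..<ord_nat m :: 'k} \<subset> {..<ord_nat n}" by auto
  then show "m < n"
    using psubset_card_mono lessThan_ord_nat by metis
next
  assume "m < n"
  moreover have "n \<le> m" if "(ord_nat n :: 'k) \<le> ord_nat m"
    using that card_mono[of "{..<ord_nat m :: 'k}" "{..<ord_nat n}"] lessThan_ord_nat by simp
  ultimately show "(ord_nat m :: 'k) < ord_nat n" by (meson not_less)
qed

text \<open>This interval is the domain of Player I's moves in round \<open>n\<close>, so its
  cardinality reveals the round number.\<close>

lemma greaterThanAtMost_ord_nat: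
  "finite {ord_zero<..ord_nat n :: 'k}" "card {ord_zero<..ord_nat n :: 'k} = n"
proof -
  have "{ord_zero<..ord_nat n :: 'k} = {..<ord_nat (Suc n)} - {ord_zero}"
  proof -
    have "{ord_zero<..ord_nat n :: 'k} = {..ord_nat n} - {ord_zero}"
      by (auto simp: order_less_le)
    also have "{..ord_nat n :: 'k} = {..<ord_nat (Suc n)}"
      using lessThan_ord_succ[OF unbounded] by (simp add: ord_nat_def)
    finally show ?thesis .
  qed
  moreover have "ord_zero \<in> {..<ord_nat (Suc n) :: 'k}"
    using ord_nat_less_iff[of 0 "Suc n"] by (simp add: ord_nat_def)
  ultimately show "finite {ord_zero<..ord_nat n :: 'k}" "card {ord_zero<..ord_nat n :: 'k} = n"
    using lessThan_ord_nat[of "Suc n"] by simp_all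
qed

text \<open>Uncountability ensures that \<omega> is an element of \<open>'k\<close>: otherwise
  \<open>ord_nat\<close> would enumerate the whole type.\<close>

lemma less_ord_omega_iff:
  assumes "uncountable (UNIV :: 'k set)"
  shows "(\<xi>::'k) < ord_omega \<longleftrightarrow> (\<exists>n. \<xi> = ord_nat n)"
proof -
  have "\<exists>\<alpha>::'k. infinite {..<\<alpha>}"
  proof (rule ccontr)
    assume "\<nexists>\<alpha>::'k. infinite {..<\<alpha>}"
    then have "UNIV = range (ord_nat :: nat \<Rightarrow> 'k)"
      using finite_lessThan_imp_ord_nat by blast
    with assms show False by (metis countable_image countableI_type)
  qed
  then have inf: "infinite {..<ord_omega :: 'k}"
    unfolding ord_omega_def by (rule LeastI_ex)
  show ?thesis
  proof
    assume "\<xi> < ord_omega"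
    then have "finite {..<\<xi>}"
      unfolding ord_omega_def using not_less_Least by blast
    then show "\<exists>n. \<xi> = ord_nat n" using finite_lessThan_imp_ord_nat by blast
  next
    assume "\<exists>n. \<xi> = ord_nat n"
    then have "finite {..<\<xi>}" using lessThan_ord_nat by blast
    then show "\<xi> < ord_omega"
      using inf finite_subset[of "{..<ord_omega}" "{..<\<xi>}"] by (auto simp: not_less[symmetric])
  qed
qed

lemma infinite_greaterThanAtMost_ord_omega:
  assumes "uncountable (UNIV :: 'k set)"
  shows "infinite {ord_zero<..ord_omega :: 'k}"
proof
  have "ord_nat (Suc n) \<in> {ord_zero<..ord_omega :: 'k}" for n
  proof -
    have "(ord_nat (Suc n)::'k) < ord_omega" using less_ord_omega_iff[OF assms] by blast
    moreover have "(ord_zero::'k) < ord_nat (Suc n)"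
      using ord_nat_less_iff[of 0 "Suc n"] by (simp add: ord_nat_def)
    ultimately show ?thesis by simp
  qed
  then have "range (\<lambda>n. ord_nat (Suc n)) \<subseteq> {ord_zero<..ord_omega :: 'k}" by blast
  moreover have "inj (\<lambda>n. ord_nat (Suc n) :: 'k)"
    by (rule linorder_injI) (metis ord_nat_less_iff Suc_less_eq less_irrefl)
  moreover assume "finite {ord_zero<..ord_omega :: 'k}"
  ultimately show False
    using finite_subset finite_imageD infinite_UNIV_nat by blast
qed

end

section \<open>Translation into a strategy for the transfinite game\<close>

lemma ex_winning_strategy_II:
  fixes f :: "('k::wellorder \<Rightarrow> 'k) \<Rightarrow> ('k \<Rightarrow> 'k)"
  assumes unbounded: "\<And>\<alpha>::'k. \<exists>\<beta>. \<alpha> < \<beta>" and unc: "uncountable (UNIV :: 'k set)"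
    and cont: "continuous_map baire_top baire_top f"
    and large: "\<And>\<alpha>. \<not> small (range f \<inter> {x. agree \<alpha> x\<^sub>0 x})"
  shows "\<exists>\<tau>. winning_strategy_II (range f) x\<^sub>0 omega_plus_one \<tau>"
proof -
  have inf: "infinite (UNIV :: 'k set)" using unc countable_finite by blast
  obtain X L where X:
    "\<And>a. X a 0 = x\<^sub>0"
    "\<And>a a' n. (\<And>i. i < n \<Longrightarrow> a i = a' i) \<Longrightarrow> X a n = X a' n"
    "\<And>a n. X a (Suc n) \<in> range f"
    "\<And>a m n. m < n \<Longrightarrow> X a m \<noteq> X a n \<and> agree (a m) (X a m) (X a n)"
    and L: "\<And>a. L a \<in> range f" "\<And>a n. X a n \<noteq> L a \<and> agree (a n) (X a n) (L a)"
    using ex_nat_strategy[OF unbounded inf cont large] by blast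
  \<comment> \<open>The domain of \<open>p\<close> has \<open>n\<close> elements in round
    \<open>n\<close> and is infinite in round \<omega>. Entries of \<open>a\<close> not yet played
    are \<open>the None\<close>; \<open>X\<close> does not depend on them by its locality.\<close>
  define \<tau> :: "'k strategy" where
    "\<tau> p q = (let a = \<lambda>n. the (p (ord_nat (Suc n))) in
       if finite (dom p) then X a (card (dom p)) else L a)" for p q
  have "legal_II (range f) \<alpha> x \<xi>"
    if x0: "x ord_zero = x\<^sub>0" and fol: "follows omega_plus_one \<tau> \<alpha> x"
      and \<xi>: "\<xi> \<in> omega_plus_one" "ord_zero < \<xi>" for \<alpha> x \<xi>
  proof -
    define a where "a n = \<alpha> (ord_nat (Suc n))" for n
    have x_eq: "x \<zeta> = \<tau> ((Some \<circ> \<alpha>) |` {ord_zero<..\<zeta>}) ((Some \<circ> x) |` {..<\<zeta>})"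
      if "\<zeta> \<le> ord_omega" "ord_zero < \<zeta>" for \<zeta>
      using fol that by (simp add: follows_def omega_plus_one_def)
    have dom: "dom (Some \<circ> \<alpha>) = UNIV" by auto
    have pos: "(ord_zero::'k) < ord_nat (Suc n)" for n
      using ord_nat_less_iff[OF unbounded, of 0 "Suc n"] by (simp add: ord_nat_def)
    have below: "(ord_nat n::'k) < ord_omega" for n
      using less_ord_omega_iff[OF unbounded unc] by blast
    have x_nat: "x (ord_nat n) = X a n" for n
    proof (cases n)
      case 0
      then show ?thesis using x0 X(1) by (simp add: ord_nat_def)
    next
      case (Suc k)
      let ?p = "(Some \<circ> \<alpha>) |` {ord_zero<..ord_nat n}"
      have "x (ord_nat n) = X (\<lambda>n. the (?p (ord_nat (Suc n)))) n"
        using x_eq[of "ord_nat n"] below[of n] pos[of k] greaterThanAtMost_ord_nat[OF unbounded, of n]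
        by (simp add: \<tau>_def dom Suc)
      also have "\<dots> = X a n"
      proof (rule X(2))
        fix i assume "i < n"
        then have "(ord_nat (Suc i)::'k) \<le> ord_nat n"
          using ord_nat_less_iff[OF unbounded, of n "Suc i"] by (simp add: not_less[symmetric])
        then show "the (?p (ord_nat (Suc i))) = a i"
          using pos[of i] by (simp add: a_def)
      qed
      finally show ?thesis .
    qed
    have x_omega: "x ord_omega = L a"
    proof -
      have "x ord_omega = L (\<lambda>n. the (((Some \<circ> \<alpha>) |` {ord_zero<..ord_omega}) (ord_nat (Suc n))))"
        using x_eq[of ord_omega] below[of 0] infinite_greaterThanAtMost_ord_omega[OF unbounded unc]
        by (simp add: \<tau>_def dom ord_nat_def)
      also have "(\<lambda>n. the (((Some \<circ> \<alpha>) |` {ord_zero<..ord_omega}) (ord_nat (Suc n)))) = a"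
        using pos below by (simp add: a_def fun_eq_iff less_imp_le)
      finally show ?thesis .
    qed
    \<comment> \<open>Agreement with position \<open>m\<close> is demanded below Player I's move in
      round \<open>m + 1\<close>, which is \<open>a m\<close> after the index shift.\<close>
    have succ: "\<alpha> (ord_succ (ord_nat m)) = a m" for m by (simp add: a_def ord_nat_def)
    show ?thesis
    proof (cases "\<xi> = ord_omega")
      case True
      then show ?thesis
        using L less_ord_omega_iff[OF unbounded unc]
        by (auto simp: legal_II_def x_omega x_nat succ agree_def)
    next
      case False
      then obtain n where n: "\<xi> = ord_nat n"
        using \<xi> less_ord_omega_iff[OF unbounded unc] by (auto simp: omega_plus_one_def le_less)
      with \<xi> obtain k where k: "n = Suc k" by (cases n) (auto simp: ord_nat_def)
      have "x \<eta> \<noteq> x \<xi> \<and> (\<forall>\<beta> < \<alpha> (ord_succ \<eta>). x \<eta> \<beta> = x \<xi> \<beta>)" if "\<eta> < \<xi>" for \<eta>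
      proof -
        have "\<eta> < ord_omega" using that n below less_trans by blast
        then obtain m where m: "\<eta> = ord_nat m"
          using less_ord_omega_iff[OF unbounded unc] by blast
        then have "m < n" using that n ord_nat_less_iff[OF unbounded] by blast
        from X(4)[OF this, of a] show ?thesis by (simp add: m n x_nat succ agree_def)
      qed
      with X(3)[of a k] show ?thesis by (simp add: legal_II_def n k x_nat)
    qed
  qed
  then show ?thesis unfolding winning_strategy_II_def by blast
qed

section \<open>Removing the small part of \<open>E\<close>\<close>

theorem theorem3p8:
  fixes E :: "('k::wellorder \<Rightarrow> 'k) set"
  assumes "uncountable_regular_cardinal TYPE('k)"
    and "closedin baire_top E"
    and "\<exists>f. continuous_map (baire_top :: ('k \<Rightarrow> 'k) topology) (baire_top :: ('k \<Rightarrow> 'k) topology) f \<and> f ` UNIV = E"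
  shows "\<exists>X \<subseteq> E. |X| \<le>o |short_seqs :: ('k \<rightharpoonup> 'k) set| \<and>
           closedin baire_top (E - X) \<and>
           (\<forall>x\<^sub>0 \<in> E - X. \<exists>\<tau>. winning_strategy_II E x\<^sub>0 omega_plus_one \<tau>)"
proof -
  have unc: "uncountable (UNIV :: 'k set)"
    using assms(1) by (simp add: uncountable_regular_cardinal_def)
  then have inf: "infinite (UNIV :: 'k set)" using countable_finite by blast
  obtain f :: "('k \<Rightarrow> 'k) \<Rightarrow> ('k \<Rightarrow> 'k)"
    where f: "continuous_map baire_top baire_top f" "range f = E" using assms(3) by blast
  define J where "J = {\<sigma>\<in>short_seqs. small (E \<inter> basic_nbhd \<sigma>)}"
  define X where "X = (\<Union>\<sigma>\<in>J. E \<inter> basic_nbhd \<sigma>)"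
  have "small X"
    unfolding X_def J_def by (rule small_UN_basic_nbhd[OF inf])
  moreover have "closedin baire_top (E - X)"
  proof -
    \<comment> \<open>Inside \<open>E\<close>, removing \<open>X\<close> amounts to removing an open
      set.\<close>
    have "E - X = E - (\<Union>\<sigma>\<in>J. basic_nbhd \<sigma>)" by (auto simp: X_def)
    moreover have "openin baire_top (\<Union>\<sigma>\<in>J. basic_nbhd \<sigma>)"
      by (intro openin_Union) (auto simp: J_def openin_baire_basic_nbhd)
    ultimately show ?thesis using assms(2) closedin_diff by metis
  qed
  moreover have "\<exists>\<tau>. winning_strategy_II E x\<^sub>0 omega_plus_one \<tau>" if "x\<^sub>0 \<in> E - X" for x\<^sub>0
  proof -
    \<comment> \<open>A small neighbourhood of the starting point in \<open>E\<close> would be one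
      of the pieces of \<open>X\<close>.\<close>
    have "\<not> small (range f \<inter> {x. agree \<alpha> x\<^sub>0 x})" for \<alpha>
    proof
      assume small: "small (range f \<inter> {x. agree \<alpha> x\<^sub>0 x})"
      obtain \<sigma> where \<sigma>: "\<sigma> \<in> short_seqs" "{x. agree \<alpha> x\<^sub>0 x} = basic_nbhd \<sigma>"
        using ex_basic_nbhd_agree by blast
      then have "x\<^sub>0 \<in> basic_nbhd \<sigma>" by auto
      with small \<sigma> that show False by (auto simp: X_def J_def f(2))
    qed
    from ex_winning_strategy_II[OF ex_greater[OF assms(1)] unc f(1) this] show ?thesis
      by (simp add: f(2))
  qed
  ultimately show ?thesis by (intro exI[of _ X]) (auto simp: X_def)
qed

end
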